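(* Every $A$-orbit with $J=0$ is quasi-periodic.
   Context: Configuration space $\mathcal H$ is $\mathbb R^3$ with coordinates $(x,y,z)$ (the Heisenberg group), with the origin excluded since it represents collision with the sun. Phase space $T^*\mathcal H$ has canonical coordinates $(x,y,z,p_x,p_y,p_z)$. The Kepler-Heisenberg Hamiltonian is $$H=\tfrac12\big((p_x-\tfrac12 yp_z)^2+(p_y+\tfrac12 xp_z)^2\big)-\frac{1}{8\pi\sqrt{(x^2+y^2)^2+16z^2}}.$$ An $A$-orbit is a solution $c:I\to T^*\mathcal H$ of Hamilton's equations for $H$ on a maximal interval $I$ such that $H=0$ along $c$, the configuration curve $(x(t),y(t),z(t))$ does not meet the $z$-axis, and $z(t)$ has at least three discrete (isolated) zeros. The dilational momentum is $J=xp_x+yp_y+2zp_z$; it satisfies $\dot J=2H$, so it is constant along solutions with $H=0$. For $\lambda>0$ the dilation is $\delta_\lambda(x,y,z,p_x,p_y,p_z)=(\lambda x,\lambda y,\lambda^2z,\lambda^{-1}p_x,\lambda^{-1}p_y,\lambda^{-2}p_z)$; for $\varphi\in\mathbb R$ the rotation $\rho_\varphi$ rotates both $(x,y)$ and $(p_x,p_y)$ by the angle $\varphi$ and fixes $z,p_z$. Quasi-periodic means periodic in time modulo a transformation of space (without any reparametrization of time): there are $T>0$, $\varphi\in\mathbb R$ and $\lambda>0$ such that for all $t\in I$ one has $t+T\in I$ and $c(t+T)=\rho_\varphi\circ\delta_\lambda(c(t))$. *)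

theory Defs
  imports "HOL-Analysis.Analysis"
begin

text \<open>A point of phase space is a pair of position \<open>(x, y, z)\<close> and momentum
  \<open>(p\<^sub>x, p\<^sub>y, p\<^sub>z)\<close>.\<close>

type_synonym phase = "(real^3) \<times> (real^3)"

text \<open>The cotangent bundle of the Heisenberg group without the origin. The z-axis away from the
  origin belongs to it.\<close>

definition phase_space :: "phase set" where
  "phase_space = {w. fst w \<noteq> 0}"

definition kh_energy :: "phase \<Rightarrow> real" where
  "kh_energy = (\<lambda>(q, p).
     ((p$1 - q$2 * p$3 / 2)\<^sup>2 + (p$2 + q$1 * p$3 / 2)\<^sup>2) / 2
     - 1 / (8 * pi * sqrt (((q$1)\<^sup>2 + (q$2)\<^sup>2)\<^sup>2 + 16 * (q$3)\<^sup>2)))"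

definition dilational_momentum :: "phase \<Rightarrow> real" where
  "dilational_momentum = (\<lambda>(q, p). q$1 * p$1 + q$2 * p$2 + 2 * q$3 * p$3)"

definition dilation :: "real \<Rightarrow> phase \<Rightarrow> phase" where
  "dilation \<mu> = (\<lambda>(q, p).
     (vector [\<mu> * q$1, \<mu> * q$2, \<mu>\<^sup>2 * q$3],
      vector [p$1 / \<mu>, p$2 / \<mu>, p$3 / \<mu>\<^sup>2]))"

definition rotation :: "real \<Rightarrow> phase \<Rightarrow> phase" where
  "rotation \<phi> = (\<lambda>(q, p).
     (vector [cos \<phi> * q$1 - sin \<phi> * q$2, sin \<phi> * q$1 + cos \<phi> * q$2, q$3],
      vector [cos \<phi> * p$1 - sin \<phi> * p$2, sin \<phi> * p$1 + cos \<phi> * p$2, p$3]))"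

definition hamiltonian_field :: "(phase \<Rightarrow> real) \<Rightarrow> phase \<Rightarrow> phase" where
  "hamiltonian_field H = (\<lambda>(q, p).
     (\<chi> i. deriv (\<lambda>s. H (q, p + s *\<^sub>R axis i 1)) 0,
      \<chi> i. - deriv (\<lambda>s. H (q + s *\<^sub>R axis i 1, p)) 0))"

text \<open>Solutions live on open intervals, as the domain of a maximal solution of a smooth ordinary
  differential equation on an open set always is. A curve is a total function of which only the
  values on \<open>I\<close> matter.\<close>

definition kh_solution :: "real set \<Rightarrow> (real \<Rightarrow> phase) \<Rightarrow> bool" where
  "kh_solution I c \<longleftrightarrow> is_interval I \<and> open I \<and> I \<noteq> {} \<and>
     (\<forall>t\<in>I. c t \<in> phase_space \<and>
            (c has_vector_derivative hamiltonian_field kh_energy (c t)) (at t))"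

definition maximal_kh_solution :: "real set \<Rightarrow> (real \<Rightarrow> phase) \<Rightarrow> bool" where
  "maximal_kh_solution I c \<longleftrightarrow> kh_solution I c \<and>
     (\<forall>I' c'. kh_solution I' c' \<and> I \<subseteq> I' \<and> (\<forall>t\<in>I. c' t = c t) \<longrightarrow> I' = I)"

definition A_orbit :: "real set \<Rightarrow> (real \<Rightarrow> phase) \<Rightarrow> bool" where
  "A_orbit I c \<longleftrightarrow> maximal_kh_solution I c \<and>
     (\<forall>t\<in>I. kh_energy (c t) = 0) \<and>
     (\<forall>t\<in>I. \<not> (fst (c t) $ 1 = 0 \<and> fst (c t) $ 2 = 0)) \<and>
     (\<exists>Z. card Z = 3 \<and> (\<forall>t\<in>Z. t isolated_in {s\<in>I. fst (c s) $ 3 = 0}))"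

definition quasi_periodic :: "real set \<Rightarrow> (real \<Rightarrow> phase) \<Rightarrow> bool" where
  "quasi_periodic I c \<longleftrightarrow>
     (\<exists>T>0. \<exists>\<phi>. \<exists>\<mu>>0. \<forall>t\<in>I. t + T \<in> I \<and> c (t + T) = rotation \<phi> (dilation \<mu> (c t)))"

end

theory Submission
  imports Defs
begin

text \<open>An orbit with \<open>J = 0\<close> is symmetric in time about each of its crossings of the plane \<open>z = 0\<close>.
  The equations of motion are invariant under reversals: a reflection of the plane together with
  \<open>z \<mapsto> - z\<close>, a change of sign of the momenta, and time reversal (\<open>kh_field_reversal\<close>).
  At a time \<open>\<tau>\<close> with \<open>z = 0\<close> the condition \<open>J = 0\<close> says that the planar momentum is
  orthogonal to the planar position, so the reversal whose axis is the line through that position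
  fixes the phase point. By uniqueness of solutions and maximality of the orbit, the orbit has a
  domain symmetric about \<open>\<tau>\<close> and is carried to itself by this reversal combined with
  \<open>t \<mapsto> 2 \<tau> - t\<close> (\<open>kh_symmetric_about_plane_crossing\<close>).

  Now take two crossing times \<open>\<sigma> < \<tau>\<close>. The reflections of time about \<open>\<sigma>\<close> and about \<open>\<tau>\<close> compose to the
  translation by \<open>2 (\<tau> - \<sigma>)\<close>, while the two reversals compose to a rotation
  (\<open>reversal_reversal\<close>). Hence the orbit is periodic up to a rotation, and the dilation factor is \<open>1\<close>.

  Uniqueness of solutions is Gronwall's argument for a field that is Lipschitz near each point of the
  domain (\<open>ode_unique\<close>).\<close>

section \<open>Functions that are Lipschitz near a point\<close>

text \<open>The Lipschitz property in a neighbourhood of one point is what uniqueness of solutions of an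
  autonomous equation needs at that point. It is closed under the operations from which the
  Kepler-Heisenberg field is built, so the field can be treated term by term, without computing
  its derivative.\<close>
definition lipschitz_near :: "('a::metric_space \<Rightarrow> 'b::metric_space) \<Rightarrow> 'a \<Rightarrow> bool" where
  "lipschitz_near f x \<longleftrightarrow> (\<exists>L. \<exists>r>0. L-lipschitz_on (ball x r) f)"

lemma lipschitz_near_imp_isCont:
  assumes "lipschitz_near f x"
  shows "isCont f x"
proof -
  obtain L r where "r > 0" "L-lipschitz_on (ball x r) f"
    using assms by (auto simp: lipschitz_near_def)
  then have "continuous_on (ball x r) f"
    by (simp add: lipschitz_on_continuous_on)
  with \<open>r > 0\<close> show ?thesis
    by (simp add: continuous_on_eq_continuous_at)
qed

lemma lipschitz_near_bounded_linear:
  assumes "bounded_linear f"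
  shows "lipschitz_near f x"
proof -
  obtain L where "L-lipschitz_on (ball x 1) f"
    using bounded_linear.lipschitz_boundE[OF assms] by blast
  then show ?thesis
    unfolding lipschitz_near_def using zero_less_one by blast
qed

lemma lipschitz_near_const: "lipschitz_near (\<lambda>_. a) x"
  unfolding lipschitz_near_def by (intro exI[of _ 0] exI[of _ 1]) (simp add: lipschitz_on_constant)

lemma lipschitz_near_compose:
  assumes "lipschitz_near f x" and "lipschitz_near g (f x)"
  shows "lipschitz_near (\<lambda>y. g (f y)) x"
proof -
  obtain L r where f: "r > 0" "L-lipschitz_on (ball x r) f"
    using assms(1) by (auto simp: lipschitz_near_def)
  obtain M s where g: "s > 0" "M-lipschitz_on (ball (f x) s) g"
    using assms(2) by (auto simp: lipschitz_near_def)
  obtain d where d: "d > 0" "\<And>y. dist y x < d \<Longrightarrow> dist (f y) (f x) < s"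
    using lipschitz_near_imp_isCont[OF assms(1)] \<open>s > 0\<close> unfolding continuous_at_eps_delta by meson
  have "L-lipschitz_on (ball x (min r d)) f"
    using f(2) by (rule lipschitz_on_subset) auto
  moreover have "M-lipschitz_on (f ` ball x (min r d)) g"
    using g(2) d(2) by (elim lipschitz_on_subset) (auto simp: dist_commute)
  ultimately have "(M * L)-lipschitz_on (ball x (min r d)) (\<lambda>y. g (f y))"
    by (rule lipschitz_on_compose2)
  then show ?thesis
    using f(1) d(1) unfolding lipschitz_near_def
    by (intro exI[of _ "M * L"] exI[of _ "min r d"]) simp
qed

lemma lipschitz_near_common_ball:
  assumes "lipschitz_near f x" and "lipschitz_near g x"
  obtains L M r where "r > 0" "L-lipschitz_on (ball x r) f" "M-lipschitz_on (ball x r) g"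
proof -
  obtain L r where f: "r > 0" "L-lipschitz_on (ball x r) f"
    using assms(1) by (auto simp: lipschitz_near_def)
  obtain M s where g: "s > 0" "M-lipschitz_on (ball x s) g"
    using assms(2) by (auto simp: lipschitz_near_def)
  have "L-lipschitz_on (ball x (min r s)) f" "M-lipschitz_on (ball x (min r s)) g"
    using f(2) g(2) by (auto elim!: lipschitz_on_subset)
  with f(1) g(1) show thesis
    using that[of "min r s"] by simp
qed

lemma lipschitz_near_add:
  fixes f g :: "'a::metric_space \<Rightarrow> 'b::real_normed_vector"
  assumes "lipschitz_near f x" and "lipschitz_near g x"
  shows "lipschitz_near (\<lambda>y. f y + g y) x"
  by (rule lipschitz_near_common_ball[OF assms]) (auto simp: lipschitz_near_def dest: lipschitz_on_add)

lemma lipschitz_near_minus: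
  fixes f :: "'a::metric_space \<Rightarrow> 'b::real_normed_vector"
  assumes "lipschitz_near f x"
  shows "lipschitz_near (\<lambda>y. - f y) x"
  using assms by (simp add: lipschitz_near_def)

lemma lipschitz_near_diff:
  fixes f g :: "'a::metric_space \<Rightarrow> 'b::real_normed_vector"
  assumes "lipschitz_near f x" and "lipschitz_near g x"
  shows "lipschitz_near (\<lambda>y. f y - g y) x"
  using lipschitz_near_add[OF assms(1) lipschitz_near_minus[OF assms(2)]] by simp

lemma lipschitz_near_Pair:
  assumes "lipschitz_near f x" and "lipschitz_near g x"
  shows "lipschitz_near (\<lambda>y. (f y, g y)) x"
  by (rule lipschitz_near_common_ball[OF assms]) (auto simp: lipschitz_near_def dest: lipschitz_on_Pair)

text \<open>A derivative that is continuous at \<open>a\<close> is bounded by \<open>\<bar>g' a\<bar> + 1\<close> on a small ball, which is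
  convex, so the mean value inequality applies there.\<close>
lemma lipschitz_near_C1:
  fixes g g' :: "real \<Rightarrow> real"
  assumes "open S" and "a \<in> S"
    and "\<And>y. y \<in> S \<Longrightarrow> (g has_real_derivative g' y) (at y)" and "isCont g' a"
  shows "lipschitz_near g a"
proof -
  obtain e where e: "e > 0" "ball a e \<subseteq> S"
    using assms(1,2) open_contains_ball by blast
  obtain d where d: "d > 0" "\<And>y. dist y a < d \<Longrightarrow> dist (g' y) (g' a) < 1"
    using assms(4) zero_less_one unfolding continuous_at_eps_delta by meson
  let ?B = "ball a (min e d)"
  have "(\<bar>g' a\<bar> + 1)-lipschitz_on ?B g"
  proof (rule lipschitz_onI)
    fix y z assume yz: "y \<in> ?B" "z \<in> ?B"
    have "norm (g y - g z) \<le> (\<bar>g' a\<bar> + 1) * norm (y - z)"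
    proof (rule field_differentiable_bound[of ?B g g'])
      fix w assume w: "w \<in> ?B"
      then show "(g has_field_derivative g' w) (at w within ?B)"
        using e(2) by (auto intro!: has_field_derivative_at_within[OF assms(3)])
      show "norm (g' w) \<le> \<bar>g' a\<bar> + 1"
        using d(2)[of w] w by (simp add: dist_real_def abs_minus_commute)
    qed (use yz in auto)
    then show "dist (g y) (g z) \<le> (\<bar>g' a\<bar> + 1) * dist y z"
      by (simp add: dist_norm)
  qed simp
  with e(1) d(1) show ?thesis
    unfolding lipschitz_near_def
    by (intro exI[of _ "\<bar>g' a\<bar> + 1"] exI[of _ "min e d"]) simp
qed

text \<open>By polarization, \<open>f g = ((f + g)\<^sup>2 - (f - g)\<^sup>2) / 4\<close>, products reduce to the square, a
  continuously differentiable function of one variable.\<close>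
lemma lipschitz_near_mult:
  fixes f g :: "'a::metric_space \<Rightarrow> real"
  assumes "lipschitz_near f x" and "lipschitz_near g x"
  shows "lipschitz_near (\<lambda>y. f y * g y) x"
proof -
  have square: "lipschitz_near (\<lambda>u::real. u\<^sup>2) a" for a
    by (rule lipschitz_near_C1[where S = UNIV and g' = "\<lambda>u. 2 * u"])
       (auto intro!: derivative_eq_intros continuous_intros)
  have scale: "lipschitz_near (\<lambda>u::real. u / 4) a" for a
    by (rule lipschitz_near_bounded_linear[OF bounded_linear_divide])
  have "lipschitz_near (\<lambda>y. (f y + g y)\<^sup>2 / 4 - (f y - g y)\<^sup>2 / 4) x"
    using assms
    by (intro lipschitz_near_diff lipschitz_near_compose[OF _ scale]
        lipschitz_near_compose[OF _ square] lipschitz_near_add)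
  then show ?thesis
    by (simp add: power2_eq_square field_simps)
qed

lemma lipschitz_near_vector_3:
  fixes f g h :: "'a::metric_space \<Rightarrow> real"
  assumes "lipschitz_near f x" and "lipschitz_near g x" and "lipschitz_near h x"
  shows "lipschitz_near (\<lambda>y. vector [f y, g y, h y] :: real^3) x"
proof -
  have lin: "lipschitz_near (\<lambda>u::real. axis i u :: real^3) a" for i a
    by (rule lipschitz_near_bounded_linear)
       (auto intro!: linear_conv_bounded_linear[THEN iffD1] linearI simp: axis_def vec_eq_iff)
  have "lipschitz_near (\<lambda>y. axis 1 (f y) + axis 2 (g y) + axis 3 (h y) :: real^3) x"
    using assms by (intro lipschitz_near_add lipschitz_near_compose[OF _ lin])
  moreover have "axis 1 a + axis 2 b + axis 3 c = (vector [a, b, c] :: real^3)" for a b c :: real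
    by (simp add: vec_eq_iff forall_3 axis_def)
  ultimately show ?thesis by simp
qed

section \<open>Uniqueness of solutions\<close>

text \<open>The squared distance \<open>u\<close> of two solutions satisfies \<open>\<bar>u'\<bar> \<le> 2 L u\<close>, so \<open>u exp (-2 L t)\<close> does not
  increase and \<open>u exp (2 L t)\<close> does not decrease (Gronwall). Since \<open>u\<close> vanishes at \<open>\<tau>\<close>, the former
  forces \<open>u \<le> 0\<close> to the right of \<open>\<tau>\<close> and the latter to the left.\<close>
lemma ode_unique_local:
  fixes F :: "'a::real_inner \<Rightarrow> 'a"
  assumes "lipschitz_near F (c \<tau>)" and "open I" and "\<tau> \<in> I"
    and c: "\<And>t. t \<in> I \<Longrightarrow> (c has_vector_derivative F (c t)) (at t)"
    and d: "\<And>t. t \<in> I \<Longrightarrow> (d has_vector_derivative F (d t)) (at t)"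
    and "c \<tau> = d \<tau>"
  obtains e where "e > 0" "\<And>t. \<bar>t - \<tau>\<bar> < e \<Longrightarrow> c t = d t"
proof -
  obtain L r where "r > 0" and L: "L-lipschitz_on (ball (c \<tau>) r) F"
    using assms(1) by (auto simp: lipschitz_near_def)
  have cont: "isCont c \<tau>" "isCont d \<tau>"
    using has_vector_derivative_continuous[OF c] has_vector_derivative_continuous[OF d] \<open>\<tau> \<in> I\<close>
    by auto
  obtain e1 where e1: "e1 > 0" "\<And>t. dist t \<tau> < e1 \<Longrightarrow> dist (c t) (c \<tau>) < r"
    using cont(1) \<open>r > 0\<close> unfolding continuous_at_eps_delta by meson
  obtain e2 where e2: "e2 > 0" "\<And>t. dist t \<tau> < e2 \<Longrightarrow> dist (d t) (d \<tau>) < r"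
    using cont(2) \<open>r > 0\<close> unfolding continuous_at_eps_delta by meson
  obtain e3 where e3: "e3 > 0" "ball \<tau> e3 \<subseteq> I"
    using \<open>open I\<close> \<open>\<tau> \<in> I\<close> open_contains_ball by blast
  define e where "e = min e1 (min e2 e3)"
  have "e > 0" using e1 e2 e3 by (simp add: e_def)
  have near: "t \<in> I" "c t \<in> ball (c \<tau>) r" "d t \<in> ball (c \<tau>) r" if "\<bar>t - \<tau>\<bar> < e" for t
  proof -
    have "dist t \<tau> < e1" "dist t \<tau> < e2" "dist t \<tau> < e3"
      using that by (simp_all add: e_def dist_real_def)
    then have "t \<in> ball \<tau> e3" "dist (c t) (c \<tau>) < r" "dist (d t) (c \<tau>) < r"
      using e1(2)[of t] e2(2)[of t] \<open>c \<tau> = d \<tau>\<close> by (simp_all add: dist_commute)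
    then show "t \<in> I" "c t \<in> ball (c \<tau>) r" "d t \<in> ball (c \<tau>) r"
      using e3(2) by (auto simp: dist_commute)
  qed
  define u where "u t = (c t - d t) \<bullet> (c t - d t)" for t
  define u' where "u' t = 2 * ((c t - d t) \<bullet> (F (c t) - F (d t)))" for t
  have u: "(u has_real_derivative u' t) (at t)" if "\<bar>t - \<tau>\<bar> < e" for t
  proof -
    have "((\<lambda>t. c t - d t) has_vector_derivative F (c t) - F (d t)) (at t)"
      using c[OF near(1)[OF that]] d[OF near(1)[OF that]] by (rule has_vector_derivative_diff)
    then have "((\<lambda>t. c t - d t) has_derivative (\<lambda>h. h *\<^sub>R (F (c t) - F (d t)))) (at t)"
      by (simp add: has_vector_derivative_def)
    from has_derivative_inner[OF this this] show ?thesis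
      unfolding u_def u'_def has_field_derivative_def
      by (rule has_derivative_eq_rhs) (simp add: fun_eq_iff inner_commute mult_ac)
  qed
  have bound: "\<bar>u' t\<bar> \<le> 2 * L * u t" if "\<bar>t - \<tau>\<bar> < e" for t
  proof -
    have "\<bar>(c t - d t) \<bullet> (F (c t) - F (d t))\<bar> \<le> norm (c t - d t) * norm (F (c t) - F (d t))"
      by (rule Cauchy_Schwarz_ineq2)
    also have "\<dots> \<le> norm (c t - d t) * (L * norm (c t - d t))"
      using lipschitz_on_normD[OF L near(2,3)[OF that]] by (intro mult_left_mono) auto
    finally show ?thesis
      by (simp add: u_def u'_def dot_square_norm power2_eq_square mult_ac abs_mult)
  qed
  have "c t = d t" if t: "\<bar>t - \<tau>\<bar> < e" for t
  proof -
    have "u t \<le> 0"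
    proof (cases "\<tau> \<le> t")
      case True
      have "u t * exp (- 2 * L * t) \<le> u \<tau> * exp (- 2 * L * \<tau>)"
      proof (rule DERIV_nonpos_imp_nonincreasing[OF True])
        fix s assume "\<tau> \<le> s" "s \<le> t"
        with t have s: "\<bar>s - \<tau>\<bar> < e" by auto
        have "((\<lambda>s. u s * exp (- 2 * L * s)) has_real_derivative
            (u' s - 2 * L * u s) * exp (- 2 * L * s)) (at s)"
          by (auto intro!: derivative_eq_intros u[OF s] simp: algebra_simps)
        moreover have "(u' s - 2 * L * u s) * exp (- 2 * L * s) \<le> 0"
          using bound[OF s] by (intro mult_nonpos_nonneg) auto
        ultimately show "\<exists>y. ((\<lambda>s. u s * exp (- 2 * L * s)) has_real_derivative y) (at s) \<and> y \<le> 0"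
          by blast
      qed
      then show ?thesis
        using \<open>c \<tau> = d \<tau>\<close> by (simp add: u_def mult_le_0_iff)
    next
      case False
      then have "t \<le> \<tau>" by simp
      have "u t * exp (2 * L * t) \<le> u \<tau> * exp (2 * L * \<tau>)"
      proof (rule DERIV_nonneg_imp_nondecreasing[OF \<open>t \<le> \<tau>\<close>])
        fix s assume "t \<le> s" "s \<le> \<tau>"
        with t have s: "\<bar>s - \<tau>\<bar> < e" by auto
        have "((\<lambda>s. u s * exp (2 * L * s)) has_real_derivative
            (u' s + 2 * L * u s) * exp (2 * L * s)) (at s)"
          by (auto intro!: derivative_eq_intros u[OF s] simp: algebra_simps)
        moreover have "(u' s + 2 * L * u s) * exp (2 * L * s) \<ge> 0"
          using bound[OF s] by (intro mult_nonneg_nonneg) auto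
        ultimately show "\<exists>y. ((\<lambda>s. u s * exp (2 * L * s)) has_real_derivative y) (at s) \<and> y \<ge> 0"
          by blast
      qed
      then show ?thesis
        using \<open>c \<tau> = d \<tau>\<close> by (simp add: u_def mult_le_0_iff)
    qed
    then show ?thesis
      using inner_ge_zero[of "c t - d t"] by (simp add: u_def antisym)
  qed
  with \<open>e > 0\<close> show thesis by (rule that)
qed

text \<open>The set on which two solutions agree is closed by continuity and open by local uniqueness, so it
  is the whole of a connected domain as soon as it is nonempty.\<close>
lemma ode_unique:
  fixes F :: "'a::real_inner \<Rightarrow> 'a"
  assumes "connected I" and "open I"
    and F: "\<And>t. t \<in> I \<Longrightarrow> lipschitz_near F (c t)"
    and c: "\<And>t. t \<in> I \<Longrightarrow> (c has_vector_derivative F (c t)) (at t)"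
    and d: "\<And>t. t \<in> I \<Longrightarrow> (d has_vector_derivative F (d t)) (at t)"
    and \<tau>: "\<tau> \<in> I" "c \<tau> = d \<tau>"
    and t: "t \<in> I"
  shows "c t = d t"
proof -
  have "continuous_on I c" "continuous_on I d"
    by (auto intro!: continuous_at_imp_continuous_on
        has_vector_derivative_continuous[OF c] has_vector_derivative_continuous[OF d])
  then have closed: "closedin (top_of_set I) {s \<in> I. c s - d s = 0}"
    by (intro continuous_closedin_preimage_constant continuous_intros)
  have "open {s \<in> I. c s - d s = 0}"
    unfolding open_dist
  proof safe
    fix s assume s: "s \<in> I" "c s - d s = 0"
    then obtain e where e: "e > 0" "\<And>t. \<bar>t - s\<bar> < e \<Longrightarrow> c t = d t"
      using ode_unique_local[OF F[of s] \<open>open I\<close> _ c d] by auto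
    obtain e' where "e' > 0" "\<And>y. dist y s < e' \<Longrightarrow> y \<in> I"
      using \<open>open I\<close> s(1) unfolding open_dist by blast
    with e show "\<exists>e>0. \<forall>y. dist y s < e \<longrightarrow> y \<in> {s \<in> I. c s - d s = 0}"
      by (intro exI[of _ "min e e'"]) (auto simp: dist_real_def)
  qed
  then have "openin (top_of_set I) {s \<in> I. c s - d s = 0}"
    by (intro open_subset) auto
  with closed \<open>connected I\<close> \<tau> have "{s \<in> I. c s - d s = 0} = I"
    unfolding connected_clopen by fastforce
  with t show ?thesis by auto
qed

section \<open>The Kepler-Heisenberg vector field\<close>

text \<open>The fourth power of the Heisenberg gauge. It vanishes at the origin only, and the potential is
  \<open>- 1 / (8 \<pi> sqrt N)\<close> with \<open>N\<close> this function, hence smooth on phase space.\<close>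
definition gauge_fourth :: "real^3 \<Rightarrow> real" where
  "gauge_fourth q = ((q$1)\<^sup>2 + (q$2)\<^sup>2)\<^sup>2 + 16 * (q$3)\<^sup>2"

lemma gauge_fourth_pos:
  assumes "q \<noteq> 0"
  shows "gauge_fourth q > 0"
proof -
  have "q$1 \<noteq> 0 \<or> q$2 \<noteq> 0 \<or> q$3 \<noteq> 0"
    using assms by (auto simp: vec_eq_iff forall_3)
  then show ?thesis
    unfolding gauge_fourth_def by (auto simp: add_nonneg_pos add_pos_nonneg
        sum_power2_gt_zero_iff sum_power2_eq_zero_iff)
qed

text \<open>The gradient of the potential at \<open>q\<close> is a quarter of this factor times the gradient of
  \<^const>\<open>gauge_fourth\<close>.\<close>
definition attraction :: "real^3 \<Rightarrow> real" where
  "attraction q = 1 / (4 * pi * (gauge_fourth q * sqrt (gauge_fourth q)))"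

text \<open>Here \<open>a\<close> and \<open>b\<close> are the momenta along the two horizontal fields of the Heisenberg group, and the
  third velocity is the rate of the area swept out by the projection to the plane.\<close>
definition kh_field :: "phase \<Rightarrow> phase" where
  "kh_field = (\<lambda>(q, p).
     let a = p$1 - q$2 * p$3 / 2; b = p$2 + q$1 * p$3 / 2; R = (q$1)\<^sup>2 + (q$2)\<^sup>2 in
     (vector [a, b, (q$1 * b - q$2 * a) / 2],
      vector [- (b * p$3 / 2) - q$1 * R * attraction q,
              a * p$3 / 2 - q$2 * R * attraction q,
              - (8 * q$3 * attraction q)]))"

lemma has_real_derivative_potential:
  fixes N :: "real \<Rightarrow> real"
  assumes "(N has_real_derivative N') (at 0)" and "N 0 = n" and "n > 0"
  shows "((\<lambda>s. 1 / (8 * pi * sqrt (N s))) has_real_derivative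
    - (N' / 4) * (1 / (4 * pi * (n * sqrt n)))) (at 0)"
  using assms
  by (auto intro!: derivative_eq_intros simp: field_simps)

lemma hamiltonian_field_eq:
  assumes "q \<noteq> 0"
  shows "hamiltonian_field kh_energy (q, p) = kh_field (q, p)"
proof -
  have N: "gauge_fourth q > 0" by (rule gauge_fourth_pos[OF assms])
  have pot: "((\<lambda>s. 1 / (8 * pi * sqrt (N s))) has_real_derivative - (N' / 4) * attraction q) (at 0)"
    if "(N has_real_derivative N') (at 0)" "N 0 = gauge_fourth q" for N N'
    using has_real_derivative_potential[OF that N] by (simp add: attraction_def)
  define U where "U q = 1 / (8 * pi * sqrt (gauge_fourth q))" for q
  have E: "kh_energy (q, p) = ((p$1 - q$2 * p$3 / 2)\<^sup>2 + (p$2 + q$1 * p$3 / 2)\<^sup>2) / 2 - U q" for q p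
    by (simp add: kh_energy_def gauge_fourth_def U_def)
  have "((\<lambda>s. gauge_fourth (q + s *\<^sub>R axis 1 1)) has_real_derivative
      4 * q$1 * ((q$1)\<^sup>2 + (q$2)\<^sup>2)) (at 0)"
    "((\<lambda>s. gauge_fourth (q + s *\<^sub>R axis 2 1)) has_real_derivative
      4 * q$2 * ((q$1)\<^sup>2 + (q$2)\<^sup>2)) (at 0)"
    "((\<lambda>s. gauge_fourth (q + s *\<^sub>R axis 3 1)) has_real_derivative 32 * q$3) (at 0)"
    unfolding gauge_fourth_def
    by (auto intro!: derivative_eq_intros simp: axis_def algebra_simps)
  note U = this[THEN pot, folded U_def, simplified]
  \<comment> \<open>Evaluating the perturbed coordinates first leaves a kinetic term polynomial in \<open>s\<close>.\<close>
  have ax: "axis (1::3) (1::real) $ 1 = 1" "axis (1::3) (1::real) $ 2 = 0" "axis (1::3) (1::real) $ 3 = 0"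
    "axis (2::3) (1::real) $ 1 = 0" "axis (2::3) (1::real) $ 2 = 1" "axis (2::3) (1::real) $ 3 = 0"
    "axis (3::3) (1::real) $ 1 = 0" "axis (3::3) (1::real) $ 2 = 0" "axis (3::3) (1::real) $ 3 = 1"
    by (simp_all add: axis_def)
  note component = vector_add_component vector_scaleR_component ax
    real_scaleR_def mult_zero_right mult_1_right add_0_right
  have
    "deriv (\<lambda>s. kh_energy (q, p + s *\<^sub>R axis 1 1)) 0 = p$1 - q$2 * p$3 / 2"
    "deriv (\<lambda>s. kh_energy (q, p + s *\<^sub>R axis 2 1)) 0 = p$2 + q$1 * p$3 / 2"
    "deriv (\<lambda>s. kh_energy (q, p + s *\<^sub>R axis 3 1)) 0
      = (q$1 * (p$2 + q$1 * p$3 / 2) - q$2 * (p$1 - q$2 * p$3 / 2)) / 2"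
    unfolding E component
    by ((rule DERIV_imp_deriv, (auto intro!: derivative_eq_intros simp: field_simps)[1])+)
  moreover have
    "deriv (\<lambda>s. kh_energy (q + s *\<^sub>R axis 1 1, p)) 0
      = (p$2 + q$1 * p$3 / 2) * p$3 / 2 + q$1 * ((q$1)\<^sup>2 + (q$2)\<^sup>2) * attraction q"
    "deriv (\<lambda>s. kh_energy (q + s *\<^sub>R axis 2 1, p)) 0
      = - ((p$1 - q$2 * p$3 / 2) * p$3 / 2) + q$2 * ((q$1)\<^sup>2 + (q$2)\<^sup>2) * attraction q"
    "deriv (\<lambda>s. kh_energy (q + s *\<^sub>R axis 3 1, p)) 0 = 8 * q$3 * attraction q"
    unfolding E component
    by ((rule DERIV_imp_deriv, (auto intro!: derivative_eq_intros U simp: field_simps)[1])+)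
  ultimately show ?thesis
    by (simp add: hamiltonian_field_def kh_field_def Let_def prod_eq_iff vec_eq_iff forall_3)
qed

text \<open>The only factor in the field that is not polynomial in the coordinates is a multiple of the cube of
  \<open>1 / sqrt N\<close>, which is smooth where \<open>N > 0\<close>.\<close>
lemma lipschitz_near_kh_field:
  assumes "w \<in> phase_space"
  shows "lipschitz_near kh_field w"
proof -
  have q: "lipschitz_near (\<lambda>w::phase. fst w $ i) w" for i
    by (intro lipschitz_near_bounded_linear bounded_linear_compose[OF bounded_linear_vec_nth]
        bounded_linear_fst)
  have p: "lipschitz_near (\<lambda>w::phase. snd w $ i) w" for i
    by (intro lipschitz_near_bounded_linear bounded_linear_compose[OF bounded_linear_vec_nth]
        bounded_linear_snd)
  note intros = q p lipschitz_near_const lipschitz_near_add lipschitz_near_diff lipschitz_near_minus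
    lipschitz_near_mult
  have N: "lipschitz_near (\<lambda>w::phase. gauge_fourth (fst w)) w"
    unfolding gauge_fourth_def power2_eq_square by (intro intros)
  have h: "lipschitz_near (\<lambda>u. inverse (sqrt u)) (gauge_fourth (fst w))"
  proof (rule lipschitz_near_C1[where S = "{0<..}"])
    show "((\<lambda>u. inverse (sqrt u)) has_real_derivative
        - (inverse (sqrt y) * (inverse (sqrt y) / 2) * inverse (sqrt y))) (at y)" if "y \<in> {0<..}" for y
      using that by (auto intro!: derivative_eq_intros)
    show "gauge_fourth (fst w) \<in> {0<..}"
      using assms by (simp add: phase_space_def gauge_fourth_pos)
    then show "isCont (\<lambda>y. - (inverse (sqrt y) * (inverse (sqrt y) / 2) * inverse (sqrt y)))
        (gauge_fourth (fst w))"
      by (intro continuous_intros) auto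
  qed simp
  have "attraction q = 1 / (4 * pi) *
      (inverse (sqrt (gauge_fourth q)) * inverse (sqrt (gauge_fourth q)) *
       inverse (sqrt (gauge_fourth q)))" for q
  proof -
    have "gauge_fourth q \<ge> 0" by (simp add: gauge_fourth_def)
    then have "sqrt (gauge_fourth q) * sqrt (gauge_fourth q) = gauge_fourth q" by simp
    then show ?thesis unfolding attraction_def by (simp add: divide_inverse mult_ac flip: inverse_mult_distrib)
  qed
  then have attraction: "lipschitz_near (\<lambda>w::phase. attraction (fst w)) w"
    by (simp only:) (intro intros lipschitz_near_compose[OF N h])
  have half: "lipschitz_near (\<lambda>w. f w / 2) w" if "lipschitz_near f w" for f :: "phase \<Rightarrow> real"
    using lipschitz_near_compose[OF that lipschitz_near_bounded_linear[OF bounded_linear_divide]] .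
  show ?thesis
    unfolding kh_field_def case_prod_unfold Let_def power2_eq_square
    by (intro lipschitz_near_Pair lipschitz_near_vector_3 intros half attraction)
qed

section \<open>The reversing symmetries\<close>

text \<open>The cotangent lift of the map that reflects the plane across the line at angle \<open>\<alpha> / 2\<close> and
  replaces \<open>z\<close> by \<open>- z\<close> (an automorphism of the Heisenberg group), followed by the change of sign
  of all momenta, which reverses time. Two signs cancel in the last momentum.\<close>
definition reversal :: "real \<Rightarrow> phase \<Rightarrow> phase" where
  "reversal \<alpha> = (\<lambda>(q, p).
     (vector [cos \<alpha> * q$1 + sin \<alpha> * q$2, sin \<alpha> * q$1 - cos \<alpha> * q$2, - q$3],
      vector [- (cos \<alpha> * p$1 + sin \<alpha> * p$2), - (sin \<alpha> * p$1 - cos \<alpha> * p$2), p$3]))"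

lemma bounded_linear_reversal: "bounded_linear (reversal \<alpha>)"
  unfolding linear_conv_bounded_linear[symmetric]
  by (rule linearI)
     (auto simp: reversal_def case_prod_unfold prod_eq_iff vec_eq_iff forall_3 algebra_simps)

text \<open>The product of the reflections across two lines is the rotation by twice the angle between them;
  the signs cancel.\<close>
lemma reversal_reversal:
  "reversal \<beta> (reversal \<alpha> w) = rotation (\<beta> - \<alpha>) w"
  by (simp add: reversal_def rotation_def case_prod_unfold prod_eq_iff vec_eq_iff forall_3
      cos_diff sin_diff algebra_simps)

lemma norm_reflection:
  fixes x y \<alpha> :: real
  shows "(cos \<alpha> * x + sin \<alpha> * y)\<^sup>2 + (sin \<alpha> * x - cos \<alpha> * y)\<^sup>2 = x\<^sup>2 + y\<^sup>2"
proof -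
  have "(cos \<alpha> * x + sin \<alpha> * y)\<^sup>2 + (sin \<alpha> * x - cos \<alpha> * y)\<^sup>2
      = ((sin \<alpha>)\<^sup>2 + (cos \<alpha>)\<^sup>2) * (x\<^sup>2 + y\<^sup>2)"
    by algebra
  then show ?thesis by simp
qed

lemma gauge_fourth_reversal: "gauge_fourth (fst (reversal \<alpha> w)) = gauge_fourth (fst w)"
  by (simp add: gauge_fourth_def reversal_def case_prod_unfold norm_reflection)

text \<open>The Hamiltonian is invariant under a reversal, which is antisymplectic, so that it carries the
  field to its negative. In coordinates: the horizontal momenta \<open>(a, b)\<close> are reflected and negated,
  and the area rate \<open>x b - y a\<close> is kept, because both factors are reflected (a sign) and one of them
  is negated (another sign).\<close>
lemma kh_field_reversal: "kh_field (reversal \<alpha> w) = - reversal \<alpha> (kh_field w)"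
proof (cases w)
  case (Pair q p)
  define q' p' where "q' = fst (reversal \<alpha> w)" and "p' = snd (reversal \<alpha> w)"
  have q'p': "q'$1 = cos \<alpha> * q$1 + sin \<alpha> * q$2" "q'$2 = sin \<alpha> * q$1 - cos \<alpha> * q$2" "q'$3 = - q$3"
    "p'$1 = - (cos \<alpha> * p$1 + sin \<alpha> * p$2)" "p'$2 = - (sin \<alpha> * p$1 - cos \<alpha> * p$2)" "p'$3 = p$3"
    by (simp_all add: q'_def p'_def reversal_def Pair)
  define a b where "a = p$1 - q$2 * p$3 / 2" and "b = p$2 + q$1 * p$3 / 2"
  define R where "R = (q$1)\<^sup>2 + (q$2)\<^sup>2"
  have a: "p'$1 - q'$2 * p'$3 / 2 = - (cos \<alpha> * a + sin \<alpha> * b)"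
    and b: "p'$2 + q'$1 * p'$3 / 2 = - (sin \<alpha> * a - cos \<alpha> * b)"
    by (simp_all add: q'p' a_def b_def field_simps)
  have R: "(q'$1)\<^sup>2 + (q'$2)\<^sup>2 = R"
    by (simp add: q'p' R_def norm_reflection)
  have attraction: "attraction q' = attraction q"
    using gauge_fourth_reversal[of \<alpha> w] by (simp add: attraction_def q'_def Pair)
  have area: "q'$1 * - (sin \<alpha> * a - cos \<alpha> * b) - q'$2 * - (cos \<alpha> * a + sin \<alpha> * b)
    = q$1 * b - q$2 * a"
  proof -
    have "q'$1 * - (sin \<alpha> * a - cos \<alpha> * b) - q'$2 * - (cos \<alpha> * a + sin \<alpha> * b)
      = ((sin \<alpha>)\<^sup>2 + (cos \<alpha>)\<^sup>2) * (q$1 * b - q$2 * a)"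
      unfolding q'p' by algebra
    then show ?thesis by simp
  qed
  have "kh_field (q', p') = - reversal \<alpha> (kh_field (q, p))"
    unfolding kh_field_def Let_def case_prod_conv a b R attraction area
    unfolding a_def[symmetric] b_def[symmetric] R_def[symmetric]
    by (simp add: q'p' reversal_def prod_eq_iff vec_eq_iff forall_3 field_simps)
  then show ?thesis by (simp add: q'_def p'_def Pair)
qed

text \<open>Reflection across the line through \<open>(x, y)\<close> fixes \<open>(x, y)\<close>. It negates the planar momentum if this
  is orthogonal to \<open>(x, y)\<close>, and the change of sign restores it.\<close>
lemma reversal_fixed_point:
  assumes "(q$1)\<^sup>2 + (q$2)\<^sup>2 \<noteq> 0" and "q$3 = 0" and "q$1 * p$1 + q$2 * p$2 = 0"
  obtains \<alpha> where "reversal \<alpha> (q, p) = (q, p)"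
proof -
  \<comment> \<open>\<open>\<theta>\<close> is the angle of the line of reflection, so the parameter of the reversal is \<open>2 \<theta>\<close>.\<close>
  obtain r \<theta> where polar: "q$1 = r * cos \<theta>" "q$2 = r * sin \<theta>"
    using polar_Ex[of "q$1" "q$2"] by blast
  with assms(1) have "r \<noteq> 0" by auto
  have "r * (cos \<theta> * p$1 + sin \<theta> * p$2) = 0"
    using assms(3) by (simp add: polar algebra_simps)
  with \<open>r \<noteq> 0\<close> have p: "cos \<theta> * p$1 + sin \<theta> * p$2 = 0" by simp
  have "cos (2 * \<theta>) * cos \<theta> + sin (2 * \<theta>) * sin \<theta> = cos \<theta>"
    "sin (2 * \<theta>) * cos \<theta> - cos (2 * \<theta>) * sin \<theta> = sin \<theta>"
    using cos_diff[of "2 * \<theta>" \<theta>] sin_diff[of "2 * \<theta>" \<theta>] by simp_all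
  then have "cos (2 * \<theta>) * q$1 + sin (2 * \<theta>) * q$2 = q$1"
    "sin (2 * \<theta>) * q$1 - cos (2 * \<theta>) * q$2 = q$2"
    unfolding polar by (metis distrib_left mult.left_commute, metis right_diff_distrib mult.left_commute)
  moreover have "cos (2 * \<theta>) * p$1 + sin (2 * \<theta>) * p$2 = 2 * cos \<theta> * (cos \<theta> * p$1 + sin \<theta> * p$2) - p$1"
    unfolding cos_double_cos sin_double by algebra
  moreover have "sin (2 * \<theta>) * p$1 - cos (2 * \<theta>) * p$2 = 2 * sin \<theta> * (cos \<theta> * p$1 + sin \<theta> * p$2) - p$2"
    unfolding cos_double_sin sin_double by algebra
  ultimately have "reversal (2 * \<theta>) (q, p) = (q, p)"
    using assms(2) p by (simp add: reversal_def prod_eq_iff vec_eq_iff forall_3)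
  then show thesis by (rule that)
qed

section \<open>Symmetry of maximal solutions and quasi-periodicity\<close>

lemma kh_solution_iff:
  "kh_solution I c \<longleftrightarrow> is_interval I \<and> open I \<and> I \<noteq> {} \<and>
     (\<forall>t\<in>I. c t \<in> phase_space \<and> (c has_vector_derivative kh_field (c t)) (at t))"
proof -
  have "hamiltonian_field kh_energy w = kh_field w" if "w \<in> phase_space" for w
    using that hamiltonian_field_eq[of "fst w" "snd w"] by (simp add: phase_space_def)
  then show ?thesis by (simp add: kh_solution_def cong: conj_cong ball_cong)
qed

lemma kh_solution_reversal:
  assumes "kh_solution I c"
  shows "kh_solution {t. 2 * \<tau> - t \<in> I} (\<lambda>t. reversal \<alpha> (c (2 * \<tau> - t)))"
  unfolding kh_solution_iff
proof (intro conjI ballI)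
  note I = assms[unfolded kh_solution_iff]
  show "is_interval {t. 2 * \<tau> - t \<in> I}"
    unfolding is_interval_1
  proof (intro ballI allI impI)
    fix a b x assume "a \<in> {t. 2 * \<tau> - t \<in> I}" "b \<in> {t. 2 * \<tau> - t \<in> I}" "a \<le> x \<and> x \<le> b"
    then show "x \<in> {t. 2 * \<tau> - t \<in> I}"
      using I mem_is_interval_1_I[of I "2 * \<tau> - b" "2 * \<tau> - a" "2 * \<tau> - x"] by simp
  qed
  show "open {t. 2 * \<tau> - t \<in> I}"
    using open_vimage[of I "\<lambda>t. 2 * \<tau> - t"] I by (simp add: vimage_def continuous_intros)
  obtain s where "s \<in> I" using I by blast
  then have "2 * \<tau> - s \<in> {t. 2 * \<tau> - t \<in> I}" by simp
  then show "{t. 2 * \<tau> - t \<in> I} \<noteq> {}" by blast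
next
  fix t assume "t \<in> {t. 2 * \<tau> - t \<in> I}"
  then have c: "c (2 * \<tau> - t) \<in> phase_space"
      "(c has_vector_derivative kh_field (c (2 * \<tau> - t))) (at (2 * \<tau> - t))"
    using assms by (auto simp: kh_solution_iff)
  \<comment> \<open>The origin is the zero set of the gauge, which the reversal preserves.\<close>
  have "fst (reversal \<alpha> (c (2 * \<tau> - t))) \<noteq> 0"
    using gauge_fourth_pos[of "fst (c (2 * \<tau> - t))"] gauge_fourth_reversal[of \<alpha> "c (2 * \<tau> - t)"] c(1)
    by (auto simp: phase_space_def gauge_fourth_def)
  then show "reversal \<alpha> (c (2 * \<tau> - t)) \<in> phase_space"
    by (simp add: phase_space_def)
  have "((\<lambda>t. c (2 * \<tau> - t)) has_vector_derivative - kh_field (c (2 * \<tau> - t))) (at t)"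
  proof -
    have "((\<lambda>t. 2 * \<tau> - t) has_vector_derivative - 1) (at t)"
      by (auto intro!: derivative_eq_intros)
    from vector_diff_chain_at[OF this c(2)] show ?thesis
      by (simp add: o_def)
  qed
  from bounded_linear.has_vector_derivative[OF bounded_linear_reversal this]
  show "((\<lambda>t. reversal \<alpha> (c (2 * \<tau> - t))) has_vector_derivative
      kh_field (reversal \<alpha> (c (2 * \<tau> - t)))) (at t)"
    by (simp add: kh_field_reversal linear_neg[OF bounded_linear.linear[OF bounded_linear_reversal]])
qed

text \<open>Two solutions with a common value agree on the common part of their domains, by uniqueness, hence
  glue to a solution on the union. Maximality of one of them leaves no room for the other outside.\<close>
lemma maximal_kh_solution_extends:
  assumes "maximal_kh_solution I c" and "kh_solution J d"
    and \<tau>: "\<tau> \<in> I" "\<tau> \<in> J" "c \<tau> = d \<tau>"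
  shows "J \<subseteq> I" and "\<And>t. t \<in> J \<Longrightarrow> c t = d t"
proof -
  have c: "kh_solution I c"
    and max: "\<And>I' c'. kh_solution I' c' \<Longrightarrow> I \<subseteq> I' \<Longrightarrow> \<forall>t\<in>I. c' t = c t \<Longrightarrow> I' = I"
    using assms(1) by (auto simp: maximal_kh_solution_def)
  note I = c[unfolded kh_solution_iff] and J = assms(2)[unfolded kh_solution_iff]
  have agree: "c t = d t" if "t \<in> I \<inter> J" for t
  proof (rule ode_unique[of "I \<inter> J"])
    show "connected (I \<inter> J)"
      using I J by (intro is_interval_connected is_interval_Int) auto
    show "open (I \<inter> J)"
      using I J by auto
    show "lipschitz_near kh_field (c s)" if "s \<in> I \<inter> J" for s
      using that I by (intro lipschitz_near_kh_field) simp
  qed (use I J \<tau> that in simp_all)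
  define e where "e t = (if t \<in> I then c t else d t)" for t
  have "kh_solution (I \<union> J) e"
    unfolding kh_solution_iff
  proof (intro conjI ballI)
    show "is_interval (I \<union> J)"
      using I J \<tau> unfolding is_interval_connected_1 by (intro connected_Un) auto
    show "open (I \<union> J)" "I \<union> J \<noteq> {}"
      using I J by auto
  next
    fix t assume t: "t \<in> I \<union> J"
    then show "e t \<in> phase_space"
      using I J by (auto simp: e_def)
    show "(e has_vector_derivative kh_field (e t)) (at t)"
    proof (cases "t \<in> I")
      case True
      with I have "(c has_vector_derivative kh_field (e t)) (at t)" by (simp add: e_def)
      then show ?thesis
        by (rule has_vector_derivative_transform_within_open[of _ _ _ I])
           (use I True in \<open>auto simp: e_def\<close>)
    next
      case False
      with t J have "(d has_vector_derivative kh_field (e t)) (at t)" by (simp add: e_def)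
      then show ?thesis
        by (rule has_vector_derivative_transform_within_open[of _ _ _ J])
           (use J False t agree in \<open>auto simp: e_def\<close>)
    qed
  qed
  then have "I \<union> J = I"
    by (rule max) (auto simp: e_def)
  then show "J \<subseteq> I" by auto
  with agree show "\<And>t. t \<in> J \<Longrightarrow> c t = d t" by auto
qed

text \<open>At \<open>z = 0\<close> the equation \<open>J = 0\<close> reads \<open>x p\<^sub>x + y p\<^sub>y = 0\<close>: the crossing is a critical point of the
  radius, and some reversal fixes the phase point. The reversed curve is then a solution through the
  same point at the same time, so it is the given solution, and the domain of the latter is symmetric
  about the time of the crossing.\<close>
lemma kh_symmetric_about_plane_crossing:
  assumes "maximal_kh_solution I c" and "\<tau> \<in> I"
    and "fst (c \<tau>) $ 3 = 0" and "dilational_momentum (c \<tau>) = 0"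
  obtains \<alpha> where "\<And>t. t \<in> I \<Longrightarrow> 2 * \<tau> - t \<in> I \<and> c (2 * \<tau> - t) = reversal \<alpha> (c t)"
proof -
  obtain q p where w: "c \<tau> = (q, p)" by (cases "c \<tau>")
  have sol: "kh_solution I c"
    using assms(1) by (simp add: maximal_kh_solution_def)
  then have "q \<noteq> 0"
    using assms(2) w by (auto simp: kh_solution_iff phase_space_def)
  with assms(3) have "(q$1)\<^sup>2 + (q$2)\<^sup>2 \<noteq> 0"
    by (auto simp: w vec_eq_iff forall_3 sum_power2_eq_zero_iff)
  moreover have "q$3 = 0" "q$1 * p$1 + q$2 * p$2 = 0"
    using assms(3,4) by (simp_all add: w dilational_momentum_def)
  ultimately obtain \<alpha> where "reversal \<alpha> (c \<tau>) = c \<tau>"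
    unfolding w by (rule reversal_fixed_point)
  then have match: "\<tau> \<in> {t. 2 * \<tau> - t \<in> I}" "c \<tau> = reversal \<alpha> (c (2 * \<tau> - \<tau>))"
    using assms(2) by simp_all
  note extends = maximal_kh_solution_extends[OF assms(1) kh_solution_reversal[OF sol] assms(2) match]
  show thesis
  proof (rule that)
    fix t assume "t \<in> I"
    then have "2 * \<tau> - t \<in> {t. 2 * \<tau> - t \<in> I}" by simp
    with extends(1) extends(2)[OF this]
    show "2 * \<tau> - t \<in> I \<and> c (2 * \<tau> - t) = reversal \<alpha> (c t)"
      by auto
  qed
qed

lemma dilation_1: "dilation 1 w = w"
  by (simp add: dilation_def case_prod_unfold prod_eq_iff vec_eq_iff forall_3)

theorem corollary4p2:
  fixes I :: "real set" and c :: "real \<Rightarrow> phase"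
  assumes "A_orbit I c"
    and "\<forall>t\<in>I. dilational_momentum (c t) = 0"
  shows "quasi_periodic I c"
proof -
  have max: "maximal_kh_solution I c"
    using assms(1) by (simp add: A_orbit_def)
  obtain Z where Z: "card Z = 3" "\<And>t. t \<in> Z \<Longrightarrow> t isolated_in {s \<in> I. fst (c s) $ 3 = 0}"
    using assms(1) by (auto simp: A_orbit_def)
  obtain x y where "x \<in> Z" "y \<in> Z" "x \<noteq> y"
    using Z(1) by (auto simp: card_3_iff)
  then obtain \<sigma> \<tau> where "\<sigma> < \<tau>" and zeros: "\<sigma> \<in> Z" "\<tau> \<in> Z"
    by (meson linorder_neqE)
  have "\<sigma> \<in> I" "fst (c \<sigma>) $ 3 = 0" "\<tau> \<in> I" "fst (c \<tau>) $ 3 = 0"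
    using Z(2)[OF zeros(1)] Z(2)[OF zeros(2)] by (auto simp: isolated_in_def)
  then obtain \<alpha> \<beta> where
    \<alpha>: "\<And>t. t \<in> I \<Longrightarrow> 2 * \<sigma> - t \<in> I \<and> c (2 * \<sigma> - t) = reversal \<alpha> (c t)" and
    \<beta>: "\<And>t. t \<in> I \<Longrightarrow> 2 * \<tau> - t \<in> I \<and> c (2 * \<tau> - t) = reversal \<beta> (c t)"
    using kh_symmetric_about_plane_crossing[OF max] assms(2) by metis
  have "t + 2 * (\<tau> - \<sigma>) \<in> I \<and> c (t + 2 * (\<tau> - \<sigma>)) = rotation (\<beta> - \<alpha>) (dilation 1 (c t))"
    if "t \<in> I" for t
  proof -
    have shift: "t + 2 * (\<tau> - \<sigma>) = 2 * \<tau> - (2 * \<sigma> - t)" by simp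
    show ?thesis
      unfolding shift using \<alpha>[OF that] \<beta>[of "2 * \<sigma> - t"] by (simp add: reversal_reversal dilation_1)
  qed
  moreover have "2 * (\<tau> - \<sigma>) > 0" using \<open>\<sigma> < \<tau>\<close> by simp
  ultimately show ?thesis
    unfolding quasi_periodic_def using zero_less_one by blast
qed

end
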